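(* Under the independent cascade model with myopic feedback, the adaptive greedy algorithm is $(1-1/e)$-approximate to the optimal non-adaptive policy: for every influence graph $G=(V,E,p)$ and every budget $1\le k\le |V|$, $$\mathrm{Greedy}_A(G,k)\ge\left(1-\frac1e\right)\mathrm{OPT}_N(G,k).$$
   Context: Influence graph: $G=(V,E,p)$, where $V$ is a finite nonempty set of nodes, $E\subseteq V\times V$ is a set of directed edges, and each edge $(u,v)\in E$ carries a probability $p_{uv}\in[0,1]$. Independent cascade (IC) model: a random live-edge graph is obtained by declaring each edge $(u,v)\in E$ live independently with probability $p_{uv}$, and blocked otherwise. A realization $\phi$ specifies the status (live or blocked) of every edge; it is identified with the corresponding live-edge graph. $\mathcal P$ denotes the distribution of the random realization $\Phi$. For $S\subseteq V$, $\Gamma(S,\phi)$ is the set of nodes reachable in $\phi$ from nodes of $S$ (including $S$ itself), $f(S,\phi)=|\Gamma(S,\phi)|$, and $\sigma(S)=\mathbb E_{\Phi\sim\mathcal P}[f(S,\Phi)]$ is the influence spread of $S$. $\mathrm{OPT}_N(G,k)=\max_{S\subseteq V,\,|S|\le k}\sigma(S)$. Myopic feedback: when $u$ is selected as a seed under realization $\phi$, the feedback $\phi(u)$ revealed is the live/blocked status of the out-going edges of $u$, and nothing else. A partial realization $\psi$ assigns to each node of a set $\mathrm{dom}(\psi)\subseteq V$ a status of its out-going edges; $\phi\sim\psi$ means $\phi(u)=\psi(u)$ for all $u\in\mathrm{dom}(\psi)$. For $u\notin\mathrm{dom}(\psi)$, $\Delta_f(u\mid\psi)=\mathbb E_{\Phi\sim\mathcal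 P}[f(\mathrm{dom}(\psi)\cup\{u\},\Phi)-f(\mathrm{dom}(\psi),\Phi)\mid\Phi\sim\psi]$. Adaptive greedy algorithm: under a realization $\phi$, start with the empty partial realization $\psi$; while $|\mathrm{dom}(\psi)|<k$, select a node $u\in V\setminus\mathrm{dom}(\psi)$ maximizing $\Delta_f(u\mid\psi)$ (ties broken arbitrarily), observe $\phi(u)$, and add $(u,\phi(u))$ to $\psi$. If $V(\mathcal A,\phi)$ is the set of $k$ nodes so selected under $\phi$, then $\mathrm{Greedy}_A(G,k)=\mathbb E_{\Phi\sim\mathcal P}[f(V(\mathcal A,\Phi),\Phi)]$. *)

theory Defs
  imports "HOL-Probability.Probability" "HOL-Library.While_Combinator"
begin

definition influence_graph :: "'v set \<Rightarrow> ('v \<times> 'v) set \<Rightarrow> ('v \<times> 'v \<Rightarrow> real) \<Rightarrow> bool" where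
  "influence_graph V E p \<longleftrightarrow>
     finite V \<and> V \<noteq> {} \<and> E \<subseteq> V \<times> V \<and> (\<forall>e\<in>E. 0 \<le> p e \<and> p e \<le> 1)"

text \<open>
  A realization is represented by its live-edge graph, i.e. the set of its live edges;
  the edges in \<open>E\<close> outside this set are blocked.
\<close>

type_synonym 'v realization = "('v \<times> 'v) set"

definition realization_pmf ::
  "('v \<times> 'v) set \<Rightarrow> ('v \<times> 'v \<Rightarrow> real) \<Rightarrow> 'v realization pmf" where
  "realization_pmf E p =
     map_pmf (\<lambda>live. {e \<in> E. live e}) (Pi_pmf E False (\<lambda>e. bernoulli_pmf (p e)))"

definition reachable_nodes :: "'v set \<Rightarrow> 'v realization \<Rightarrow> 'v set" where
  "reachable_nodes S \<phi> = \<phi>\<^sup>* `` S"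

definition spread :: "'v set \<Rightarrow> 'v realization \<Rightarrow> real" where
  "spread S \<phi> = real (card (reachable_nodes S \<phi>))"

definition influence_spread ::
  "('v \<times> 'v) set \<Rightarrow> ('v \<times> 'v \<Rightarrow> real) \<Rightarrow> 'v set \<Rightarrow> real" where
  "influence_spread E p S =
     measure_pmf.expectation (realization_pmf E p) (\<lambda>\<phi>. spread S \<phi>)"

definition OPT_N ::
  "'v set \<Rightarrow> ('v \<times> 'v) set \<Rightarrow> ('v \<times> 'v \<Rightarrow> real) \<Rightarrow> nat \<Rightarrow> real" where
  "OPT_N V E p k = Max (influence_spread E p ` {S. S \<subseteq> V \<and> card S \<le> k})"

text \<open>
  The status of the out-going edges of \<open>u\<close> is recorded as the set of heads of its live
  out-going edges.
\<close>

type_synonym 'v feedback = "'v set"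

type_synonym 'v partial_realization = "'v \<rightharpoonup> 'v feedback"

definition myopic_feedback :: "'v realization \<Rightarrow> 'v \<Rightarrow> 'v feedback" where
  "myopic_feedback \<phi> u = \<phi> `` {u}"

definition consistent :: "'v realization \<Rightarrow> 'v partial_realization \<Rightarrow> bool" where
  "consistent \<phi> \<psi> \<longleftrightarrow> (\<forall>u\<in>dom \<psi>. \<psi> u = Some (myopic_feedback \<phi> u))"

text \<open>
  The following conditional expectation is meaningful only if some realization of positive
  probability is consistent with \<open>\<psi>\<close>; otherwise \<^const>\<open>cond_pmf\<close> is unspecified.
\<close>

definition expected_gain ::
  "('v \<times> 'v) set \<Rightarrow> ('v \<times> 'v \<Rightarrow> real) \<Rightarrow> 'v partial_realization \<Rightarrow> 'v \<Rightarrow> real" where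
  "expected_gain E p \<psi> u =
     measure_pmf.expectation (cond_pmf (realization_pmf E p) {\<phi>. consistent \<phi> \<psi>})
       (\<lambda>\<phi>. spread (dom \<psi> \<union> {u}) \<phi> - spread (dom \<psi>) \<phi>)"

text \<open>
  A selection rule maps the partial realization observed so far to the next seed. It is
  greedy if it always picks a maximizer of the expected gain; the choice among several
  maximizers is left open. Partial realizations of probability zero are never observed by
  the algorithm (almost surely) and have no well-defined expected gain, so they are
  unconstrained.
\<close>

definition greedy_rule ::
  "'v set \<Rightarrow> ('v \<times> 'v) set \<Rightarrow> ('v \<times> 'v \<Rightarrow> real) \<Rightarrow> nat \<Rightarrow>
   ('v partial_realization \<Rightarrow> 'v) \<Rightarrow> bool" where
  "greedy_rule V E p k \<pi> \<longleftrightarrow>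
     (\<forall>\<psi>. dom \<psi> \<subseteq> V \<and> card (dom \<psi>) < k \<and>
          (\<exists>\<phi>\<in>set_pmf (realization_pmf E p). consistent \<phi> \<psi>) \<longrightarrow>
        is_arg_max (expected_gain E p \<psi>) (\<lambda>u. u \<in> V - dom \<psi>) (\<pi> \<psi>))"

definition selected_seeds ::
  "('v partial_realization \<Rightarrow> 'v) \<Rightarrow> nat \<Rightarrow> 'v realization \<Rightarrow> 'v set" where
  "selected_seeds \<pi> k \<phi> =
     dom (while (\<lambda>\<psi>. card (dom \<psi>) < k)
                (\<lambda>\<psi>. \<psi>(\<pi> \<psi> \<mapsto> myopic_feedback \<phi> (\<pi> \<psi>)))
                Map.empty)"

definition Greedy_A ::
  "('v \<times> 'v) set \<Rightarrow> ('v \<times> 'v \<Rightarrow> real) \<Rightarrow> nat \<Rightarrow>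
   ('v partial_realization \<Rightarrow> 'v) \<Rightarrow> real" where
  "Greedy_A E p k \<pi> =
     measure_pmf.expectation (realization_pmf E p) (\<lambda>\<phi>. spread (selected_seeds \<pi> k \<phi>) \<phi>)"

end

theory Submission
  imports Defs
begin

text \<open>
  Fix a set \<open>S\<close> of at most \<open>k\<close> nodes and let \<open>V\<^sub>i\<close> be the random set of the first \<open>i\<close> greedy
  seeds. Given the observations \<open>\<psi>\<close> so far, submodularity of the spread in every realization
  bounds the conditional expectation of \<open>f(V\<^sub>i \<union> S) - f(V\<^sub>i)\<close> by the sum of the expected
  gains of the nodes of \<open>S\<close>, hence by \<open>k\<close> times the gain of the greedy choice. Conditionally on
  \<open>\<psi>\<close>, the spread of \<open>V\<^sub>i \<union> S\<close> may be smaller than \<open>\<sigma>(S)\<close>; but after averaging over \<open>\<psi>\<close>,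
  monotonicity gives \<open>E f(V\<^sub>i \<union> S) \<ge> \<sigma>(S)\<close>. So
  \<open>\<sigma>(S) - E f(V\<^sub>i)\<close> shrinks by a factor \<open>1 - 1/k\<close> in each step.
\<close>

section \<open>Expectations under finitely supported distributions\<close>

lemma expectation_mono_finite:
  fixes f g :: "'a \<Rightarrow> real"
  assumes "finite (set_pmf M)" "\<And>x. x \<in> set_pmf M \<Longrightarrow> f x \<le> g x"
  shows "measure_pmf.expectation M f \<le> measure_pmf.expectation M g"
  using assms by (intro integral_mono_AE)
    (auto simp: AE_measure_pmf_iff intro: integrable_measure_pmf_finite)

text \<open>Multiplying by the probability of \<open>A\<close> clears the denominators of
  \<open>cond_pmf\<close>, which leaves terms that add up over disjoint events.\<close>

lemma measure_times_expectation_cond_pmf: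
  fixes h :: "'a \<Rightarrow> real"
  assumes "finite (set_pmf M)" "set_pmf M \<inter> A \<noteq> {}"
  shows "measure_pmf.prob M A * measure_pmf.expectation (cond_pmf M A) h =
    (\<Sum>x\<in>set_pmf M \<inter> A. pmf M x * h x)"
proof -
  have "measure_pmf.prob M A > 0"
    using assms(2) by (simp add: measure_measure_pmf_not_zero zero_less_measure_iff)
  moreover have "measure_pmf.expectation (cond_pmf M A) h =
      (\<Sum>x\<in>set_pmf M \<inter> A. pmf M x / measure_pmf.prob M A * h x)"
    using assms by (subst integral_measure_pmf[where A = "set_pmf M \<inter> A"])
      (auto simp: set_cond_pmf pmf_cond intro!: sum.cong)
  ultimately show ?thesis
    by (simp add: sum_distrib_left)
qed

text \<open>Law of total expectation along the fibres of \<open>X\<close>. The event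
  \<open>A y\<close> has to agree with the fibre over \<open>y\<close> only on the support, so
  consistency events can take its place although they also contain edge sets of probability
  zero.\<close>

lemma expectation_nonneg_if_cond_nonneg:
  fixes h :: "'a \<Rightarrow> real"
  assumes fin: "finite (set_pmf M)"
    and nonneg: "\<And>y. y \<in> X ` set_pmf M \<Longrightarrow>
      0 \<le> measure_pmf.expectation (cond_pmf M (A y)) h"
    and fibre: "\<And>x y. x \<in> set_pmf M \<Longrightarrow> y \<in> X ` set_pmf M \<Longrightarrow> x \<in> A y \<longleftrightarrow> X x = y"
  shows "0 \<le> measure_pmf.expectation M h"
proof -
  have "0 \<le> (\<Sum>x\<in>{x \<in> set_pmf M. X x = y}. pmf M x * h x)" if y: "y \<in> X ` set_pmf M" for y
  proof -
    have "{x \<in> set_pmf M. X x = y} = set_pmf M \<inter> A y"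
      using fibre y by auto
    moreover have "set_pmf M \<inter> A y \<noteq> {}"
      using fibre y by auto
    moreover have "0 \<le> measure_pmf.prob M (A y) * measure_pmf.expectation (cond_pmf M (A y)) h"
      using nonneg[OF y] by simp
    ultimately show ?thesis
      using measure_times_expectation_cond_pmf[OF fin, of "A y" h] by simp
  qed
  then have "0 \<le> (\<Sum>y\<in>X ` set_pmf M. \<Sum>x\<in>{x \<in> set_pmf M. X x = y}. pmf M x * h x)"
    by (rule sum_nonneg)
  also have "\<dots> = (\<Sum>x\<in>set_pmf M. pmf M x * h x)"
    using sum.image_gen[OF fin, of "\<lambda>x. pmf M x * h x" X] by simp
  also have "\<dots> = measure_pmf.expectation M h"
    using fin by (subst integral_measure_pmf[where A = "set_pmf M"]) auto
  finally show ?thesis .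
qed

section \<open>Loop unrolling and the recurrence behind 1 - 1/e\<close>

lemma while_eq_funpow:
  assumes "\<And>i. i < n \<Longrightarrow> b ((c ^^ i) s)" "\<not> b ((c ^^ n) s)"
  shows "while b c s = (c ^^ n) s"
  using assms
proof (induction n arbitrary: s)
  case 0
  then show ?case by (simp add: while_unfold)
next
  case (Suc n)
  have "b s"
    using Suc.prems(1)[of 0] by simp
  moreover have "while b c (c s) = (c ^^ n) (c s)"
    using Suc.IH[of "c s"] Suc.prems by (metis Suc_mono comp_apply funpow_Suc_right)
  ultimately show ?case
    by (simp add: while_unfold funpow_swap1)
qed

text \<open>The gap \<open>c - a i\<close> is at most \<open>c\<close> at the start, because
  \<open>0 \<le> a 0\<close>, and each step bounds the new gap by 1 - 1/k times the old one. After k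
  steps it is at most (1 - 1/k)^k c, hence at most c/e.\<close>

lemma contraction_lower_bound:
  fixes a :: "nat \<Rightarrow> real"
  assumes "1 \<le> k" "0 \<le> a 0" "0 \<le> c"
    and step: "\<And>i. i < k \<Longrightarrow> c - a i \<le> real k * (a (Suc i) - a i)"
  shows "(1 - 1 / exp 1) * c \<le> a k"
proof -
  let ?q = "1 - 1 / real k"
  have q: "0 \<le> ?q" using assms(1) by simp
  have "c - a i \<le> ?q ^ i * c" if "i \<le> k" for i
    using that
  proof (induction i)
    case 0
    then show ?case using assms by simp
  next
    case (Suc i)
    have "c - a (Suc i) \<le> ?q * (c - a i)"
      using step[of i] Suc.prems assms(1) by (simp add: field_simps)
    also have "\<dots> \<le> ?q * (?q ^ i * c)"
      using Suc q by (intro mult_left_mono) auto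
    finally show ?case by simp
  qed
  then have "c - a k \<le> ?q ^ k * c" by simp
  \<comment> \<open>This is 1 + x \<le> exp x at x = -1/k; the k-th power preserves it because
    \<open>?q\<close> is nonnegative.\<close>
  also have "?q ^ k \<le> exp (- 1 / real k) ^ k"
    using q exp_ge_add_one_self[of "- 1 / real k"] by (intro power_mono) auto
  also have "exp (- 1 / real k) ^ k = 1 / exp 1"
    using assms(1) by (simp add: exp_of_nat_mult[symmetric] exp_minus field_simps)
  finally show ?thesis
    using assms(3) by (simp add: algebra_simps mult_right_mono)
qed

section \<open>Monotonicity and submodularity of the spread in a fixed realization\<close>

lemma spread_nonneg: "0 \<le> spread S \<phi>"
  by (simp add: spread_def)

lemma finite_reachable_nodes:
  assumes "finite V" "\<phi> \<subseteq> V \<times> V" "S \<subseteq> V"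
  shows "finite (reachable_nodes S \<phi>)"
proof -
  have "reachable_nodes S \<phi> \<subseteq> V"
    unfolding reachable_nodes_def
    using assms(2,3) by (auto elim: rtranclE)
  then show ?thesis using assms(1) finite_subset by blast
qed

lemma spread_mono:
  assumes "finite V" "\<phi> \<subseteq> V \<times> V" "T \<subseteq> V" "S \<subseteq> T"
  shows "spread S \<phi> \<le> spread T \<phi>"
  unfolding spread_def
  using finite_reachable_nodes[OF assms(1-3)] assms(4)
  by (auto simp: reachable_nodes_def intro!: card_mono)

text \<open>Reachability commutes with unions of sources, so the spread is a coverage function.
  Inclusion-exclusion applies to the nodes reached from \<open>A \<union> B\<close> and from
  \<open>A \<union> C\<close>, and their intersection contains all that \<open>A\<close>
  reaches.\<close>

lemma spread_submodular:
  assumes "finite V" "\<phi> \<subseteq> V \<times> V" "A \<subseteq> V" "B \<subseteq> V" "C \<subseteq> V"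
  shows "spread (A \<union> B \<union> C) \<phi> + spread A \<phi> \<le> spread (A \<union> B) \<phi> + spread (A \<union> C) \<phi>"
proof -
  let ?r = "\<lambda>S. reachable_nodes S \<phi>"
  have fin: "finite (?r (A \<union> B))" "finite (?r (A \<union> C))"
    using assms by (auto intro: finite_reachable_nodes)
  have "?r (A \<union> B \<union> C) = ?r (A \<union> B) \<union> ?r (A \<union> C)"
    and "?r A \<subseteq> ?r (A \<union> B) \<inter> ?r (A \<union> C)"
    by (auto simp: reachable_nodes_def)
  then have "card (?r (A \<union> B \<union> C)) + card (?r A) \<le> card (?r (A \<union> B)) + card (?r (A \<union> C))"
    using card_Un_Int[OF fin] card_mono[of "?r (A \<union> B) \<inter> ?r (A \<union> C)" "?r A"] fin by simp
  then show ?thesis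
    unfolding spread_def by (metis of_nat_add of_nat_mono)
qed

text \<open>Add the nodes of \<open>S\<close> to \<open>D\<close> one at a time: by submodularity
  each contributes at most its gain over \<open>D\<close> alone.\<close>

lemma spread_Un_le_sum_gains:
  assumes "finite V" "\<phi> \<subseteq> V \<times> V" "D \<subseteq> V" "S \<subseteq> V"
  shows "spread (D \<union> S) \<phi> - spread D \<phi> \<le> (\<Sum>u\<in>S. spread (D \<union> {u}) \<phi> - spread D \<phi>)"
  using finite_subset[OF assms(4,1)] assms(4)
proof (induction S rule: finite_induct)
  case (insert u S)
  have "spread (D \<union> insert u S) \<phi> + spread D \<phi> \<le> spread (D \<union> S) \<phi> + spread (D \<union> {u}) \<phi>"
    using spread_submodular[OF assms(1-3), of S "{u}"] insert.prems by simp
  then show ?case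
    using insert by simp
qed simp

lemma realization_subset_edges: "\<phi> \<in> set_pmf (realization_pmf E p) \<Longrightarrow> \<phi> \<subseteq> E"
  by (auto simp: realization_pmf_def)

lemma finite_set_realization_pmf: "finite E \<Longrightarrow> finite (set_pmf (realization_pmf E p))"
  by (rule finite_subset[of _ "Pow E"]) (auto dest: realization_subset_edges)

section \<open>The run of a greedy policy under a realization\<close>

locale greedy_policy =
  fixes V :: "'v set" and E :: "('v \<times> 'v) set" and p :: "'v \<times> 'v \<Rightarrow> real"
    and k :: nat and \<pi> :: "'v partial_realization \<Rightarrow> 'v"
  assumes graph: "influence_graph V E p"
    and greedy: "greedy_rule V E p k \<pi>"
begin

abbreviation "M \<equiv> realization_pmf E p"

definition observe :: "'v realization \<Rightarrow> 'v partial_realization \<Rightarrow> 'v partial_realization" where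
  "observe \<phi> \<psi> = \<psi>(\<pi> \<psi> \<mapsto> myopic_feedback \<phi> (\<pi> \<psi>))"

text \<open>Iterates of the loop body give access to the state after every number of selections,
  which the step-by-step analysis needs.\<close>

definition observed :: "nat \<Rightarrow> 'v realization \<Rightarrow> 'v partial_realization" where
  "observed i \<phi> = (observe \<phi> ^^ i) Map.empty"

lemma observed_0 [simp]: "observed 0 \<phi> = Map.empty"
  by (simp add: observed_def)

lemma observed_Suc: "observed (Suc i) \<phi> = observe \<phi> (observed i \<phi>)"
  by (simp add: observed_def)

lemma dom_observe: "dom (observe \<phi> \<psi>) = insert (\<pi> \<psi>) (dom \<psi>)"
  by (simp add: observe_def)

lemma observe_apply:
  "observe \<phi> \<psi> u = (if u = \<pi> \<psi> then Some (myopic_feedback \<phi> (\<pi> \<psi>)) else \<psi> u)"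
  by (simp add: observe_def)

lemma finite_nodes: "finite V" and edges: "E \<subseteq> V \<times> V"
  using graph by (auto simp: influence_graph_def)

lemma finite_support: "finite (set_pmf M)"
  using finite_nodes edges by (intro finite_set_realization_pmf) (auto intro: finite_subset)

lemma support_edges: "\<phi> \<in> set_pmf M \<Longrightarrow> \<phi> \<subseteq> V \<times> V"
  using realization_subset_edges edges by blast

text \<open>The realization \<open>\<phi>\<close> witnesses that \<open>\<psi>\<close> has positive
  probability; the greedy rule constrains the choice only for such \<open>\<psi>\<close>.\<close>

lemma greedy_choice:
  assumes "dom \<psi> \<subseteq> V" "card (dom \<psi>) < k" "\<phi> \<in> set_pmf M" "consistent \<phi> \<psi>"
  shows "\<pi> \<psi> \<in> V - dom \<psi>"
    and "u \<in> V - dom \<psi> \<Longrightarrow> expected_gain E p \<psi> u \<le> expected_gain E p \<psi> (\<pi> \<psi>)"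
proof -
  have "is_arg_max (expected_gain E p \<psi>) (\<lambda>u. u \<in> V - dom \<psi>) (\<pi> \<psi>)"
    using greedy assms unfolding greedy_rule_def by blast
  then show "\<pi> \<psi> \<in> V - dom \<psi>"
    and "u \<in> V - dom \<psi> \<Longrightarrow> expected_gain E p \<psi> u \<le> expected_gain E p \<psi> (\<pi> \<psi>)"
    unfolding is_arg_max_linorder by blast+
qed

lemma observed_invariant:
  assumes "\<phi> \<in> set_pmf M" "i \<le> k"
  shows "dom (observed i \<phi>) \<subseteq> V \<and> card (dom (observed i \<phi>)) = i \<and> consistent \<phi> (observed i \<phi>)"
  using assms(2)
proof (induction i)
  case 0
  then show ?case by (simp add: consistent_def)
next
  case (Suc i)
  let ?\<psi> = "observed i \<phi>"
  have IH: "dom ?\<psi> \<subseteq> V" "card (dom ?\<psi>) = i" "consistent \<phi> ?\<psi>"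
    using Suc by auto
  then have "\<pi> ?\<psi> \<in> V - dom ?\<psi>"
    using greedy_choice(1)[OF _ _ assms(1)] Suc.prems by simp
  moreover have "finite (dom ?\<psi>)"
    using IH(1) finite_nodes finite_subset by blast
  ultimately show ?case
    using IH unfolding consistent_def observed_Suc dom_observe
    by (auto simp: observe_apply)
qed

text \<open>Each iteration selects exactly one new node, so the loop guard first fails after k
  iterations.\<close>

lemma selected_seeds_eq:
  assumes "\<phi> \<in> set_pmf M"
  shows "selected_seeds \<pi> k \<phi> = dom (observed k \<phi>)"
proof -
  have "while (\<lambda>\<psi>. card (dom \<psi>) < k) (observe \<phi>) Map.empty = (observe \<phi> ^^ k) Map.empty"
    using observed_invariant[OF assms]
    by (intro while_eq_funpow) (auto simp: observed_def)
  then show ?thesis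
    by (simp add: selected_seeds_def observed_def observe_def[abs_def])
qed

text \<open>The policy depends only on what it has observed. A realization that agrees with the
  recorded feedback therefore leads it through the same choices, one after the other.\<close>

lemma observed_eq_if_consistent:
  assumes "\<phi> \<in> set_pmf M" "i \<le> k" "consistent \<phi>' (observed i \<phi>)"
  shows "observed i \<phi>' = observed i \<phi>"
  using assms(2,3)
proof (induction i)
  case (Suc i)
  let ?\<psi> = "observed i \<phi>"
  \<comment> \<open>The update at \<open>\<pi> ?\<psi>\<close> overwrites no earlier entry, so
    consistency with the longer record passes to the shorter one.\<close>
  have new: "\<pi> ?\<psi> \<notin> dom ?\<psi>"
    using observed_invariant[OF assms(1), of i] greedy_choice(1)[OF _ _ assms(1)] Suc.prems(1)
    by simp
  have "consistent \<phi>' ?\<psi>"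
    unfolding consistent_def
  proof
    fix u assume u: "u \<in> dom ?\<psi>"
    then have "u \<in> dom (observed (Suc i) \<phi>)"
      by (simp add: observed_Suc dom_observe)
    then have "observed (Suc i) \<phi> u = Some (myopic_feedback \<phi>' u)"
      using Suc.prems(2) unfolding consistent_def by blast
    then show "?\<psi> u = Some (myopic_feedback \<phi>' u)"
      using u new by (auto simp: observed_Suc observe_apply split: if_splits)
  qed
  then have IH: "observed i \<phi>' = ?\<psi>"
    using Suc by simp
  have "myopic_feedback \<phi>' (\<pi> ?\<psi>) = myopic_feedback \<phi> (\<pi> ?\<psi>)"
    using Suc.prems(2) unfolding consistent_def observed_Suc dom_observe
    by (simp add: observe_apply)
  then show ?case
    by (simp add: observed_Suc observe_def IH)
qed simp

text \<open>On the support, the fibres of \<open>observed i\<close> are thus the very events on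
  which \<open>expected_gain\<close> conditions.\<close>

lemma consistent_observed_iff:
  assumes "\<phi> \<in> set_pmf M" "\<phi>' \<in> set_pmf M" "i \<le> k"
  shows "consistent \<phi>' (observed i \<phi>) \<longleftrightarrow> observed i \<phi>' = observed i \<phi>"
  using observed_eq_if_consistent[OF assms(1,3)] observed_invariant[OF assms(2,3)] by metis

section \<open>Progress made by one greedy step\<close>

lemma cond_gain_ge:
  assumes "\<phi> \<in> set_pmf M" "consistent \<phi> \<psi>" "dom \<psi> \<subseteq> V" "card (dom \<psi>) < k"
    and S: "S \<subseteq> V" "card S \<le> k"
  shows "measure_pmf.expectation (cond_pmf M {\<phi>. consistent \<phi> \<psi>})
      (\<lambda>\<phi>. spread (dom \<psi> \<union> S) \<phi> - spread (dom \<psi>) \<phi>)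
    \<le> real k * expected_gain E p \<psi> (\<pi> \<psi>)"
proof -
  let ?C = "cond_pmf M {\<phi>. consistent \<phi> \<psi>}"
  let ?D = "dom \<psi>" and ?g = "expected_gain E p \<psi>"
  have supp: "set_pmf ?C = set_pmf M \<inter> {\<phi>. consistent \<phi> \<psi>}"
    using assms(1,2) by (intro set_cond_pmf) auto
  then have fin: "finite (set_pmf ?C)"
    using finite_support by simp
  have sub: "\<phi> \<subseteq> V \<times> V" if "\<phi> \<in> set_pmf ?C" for \<phi>
    using that supp support_edges by auto
  have choice: "\<pi> \<psi> \<in> V - ?D" "\<And>u. u \<in> V - ?D \<Longrightarrow> ?g u \<le> ?g (\<pi> \<psi>)"
    using greedy_choice[OF assms(3,4,1,2)] by auto
  \<comment> \<open>Needed twice: for nodes of \<open>S\<close> that are already selected, whose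
    gain is zero and which greedy maximality does not cover, and for replacing \<open>card S\<close>
    by \<open>k\<close>.\<close>
  have gain_nonneg: "0 \<le> ?g (\<pi> \<psi>)"
    unfolding expected_gain_def
    using sub choice(1) assms(3)
    by (intro Bochner_Integration.integral_nonneg_AE)
      (auto simp: AE_measure_pmf_iff intro!: spread_mono[OF finite_nodes])
  have "measure_pmf.expectation ?C (\<lambda>\<phi>. spread (?D \<union> S) \<phi> - spread ?D \<phi>)
      \<le> measure_pmf.expectation ?C (\<lambda>\<phi>. \<Sum>u\<in>S. spread (?D \<union> {u}) \<phi> - spread ?D \<phi>)"
    using fin sub assms(3) S(1)
    by (intro expectation_mono_finite spread_Un_le_sum_gains[OF finite_nodes])
  also have "\<dots> = (\<Sum>u\<in>S. ?g u)"
    unfolding expected_gain_def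
    by (intro Bochner_Integration.integral_sum integrable_measure_pmf_finite fin)
  also have "\<dots> \<le> real (card S) * ?g (\<pi> \<psi>)"
  proof (rule sum_bounded_above)
    fix u assume "u \<in> S"
    show "?g u \<le> ?g (\<pi> \<psi>)"
    proof (cases "u \<in> ?D")
      case True
      then have "?g u = 0"
        by (simp add: expected_gain_def insert_absorb)
      then show ?thesis using gain_nonneg by simp
    next
      case False
      then show ?thesis using choice(2) \<open>u \<in> S\<close> S(1) by auto
    qed
  qed
  also have "\<dots> \<le> real k * ?g (\<pi> \<psi>)"
    using S(2) gain_nonneg by (intro mult_right_mono) auto
  finally show ?thesis .
qed

definition value_after :: "nat \<Rightarrow> real" where
  "value_after i = measure_pmf.expectation M (\<lambda>\<phi>. spread (dom (observed i \<phi>)) \<phi>)"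

lemma value_after_step:
  assumes "i < k" "S \<subseteq> V" "card S \<le> k"
  shows "influence_spread E p S - value_after i \<le> real k * (value_after (Suc i) - value_after i)"
proof -
  let ?D = "\<lambda>i \<phi>. dom (observed i \<phi>)"
  note int = integrable_measure_pmf_finite[OF finite_support]
  \<comment> \<open>The slack of the step inequality in a single realization. It can be negative
    there; its sign is known only in conditional expectation given the first \<open>i\<close>
    observations.\<close>
  define h where "h \<phi> = real k * (spread (?D (Suc i) \<phi>) \<phi> - spread (?D i \<phi>) \<phi>)
    - (spread (?D i \<phi> \<union> S) \<phi> - spread (?D i \<phi>) \<phi>)" for \<phi>
  have "0 \<le> measure_pmf.expectation M h"
  proof (rule expectation_nonneg_if_cond_nonneg[OF finite_support,
        where X = "observed i" and A = "\<lambda>\<psi>. {\<phi>. consistent \<phi> \<psi>}"])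
    fix \<psi> assume "\<psi> \<in> observed i ` set_pmf M"
    then obtain \<phi> where \<phi>: "\<phi> \<in> set_pmf M" "\<psi> = observed i \<phi>"
      by blast
    then have inv: "dom \<psi> \<subseteq> V" "card (dom \<psi>) < k" "consistent \<phi> \<psi>"
      using observed_invariant[of \<phi> i] assms(1) by auto
    let ?C = "cond_pmf M {\<phi>. consistent \<phi> \<psi>}"
    have supp: "set_pmf ?C = set_pmf M \<inter> {\<phi>. consistent \<phi> \<psi>}"
      using \<phi>(1) inv(3) by (intro set_cond_pmf) auto
    note intC = integrable_measure_pmf_finite[of ?C]
    have fin: "finite (set_pmf ?C)"
      using finite_support supp by simp
    \<comment> \<open>Under \<open>?C\<close> the state after \<open>i\<close> steps is constantly
      \<open>\<psi>\<close>, so the random seed sets in \<open>h\<close> become fixed sets and its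
      first term averages to \<open>k\<close> times the expected greedy gain.\<close>
    have "measure_pmf.expectation ?C h = measure_pmf.expectation ?C
        (\<lambda>\<phi>. real k * (spread (dom \<psi> \<union> {\<pi> \<psi>}) \<phi> - spread (dom \<psi>) \<phi>)
          - (spread (dom \<psi> \<union> S) \<phi> - spread (dom \<psi>) \<phi>))"
    proof (intro integral_cong_AE)
      show "AE \<phi>' in ?C. h \<phi>' = real k * (spread (dom \<psi> \<union> {\<pi> \<psi>}) \<phi>' - spread (dom \<psi>) \<phi>')
          - (spread (dom \<psi> \<union> S) \<phi>' - spread (dom \<psi>) \<phi>')"
        unfolding AE_measure_pmf_iff
      proof
        fix \<phi>' assume "\<phi>' \<in> set_pmf ?C"
        then have "observed i \<phi>' = \<psi>"
          using supp observed_eq_if_consistent[OF \<phi>(1)] \<phi>(2) assms(1) by simp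
        then show "h \<phi>' = real k * (spread (dom \<psi> \<union> {\<pi> \<psi>}) \<phi>' - spread (dom \<psi>) \<phi>')
          - (spread (dom \<psi> \<union> S) \<phi>' - spread (dom \<psi>) \<phi>')"
          by (simp add: h_def observed_Suc dom_observe)
      qed
    qed simp_all
    also have "\<dots> = real k * expected_gain E p \<psi> (\<pi> \<psi>)
        - measure_pmf.expectation ?C (\<lambda>\<phi>. spread (dom \<psi> \<union> S) \<phi> - spread (dom \<psi>) \<phi>)"
      unfolding expected_gain_def
      by (subst Bochner_Integration.integral_diff) (auto intro: intC[OF fin])
    finally show "0 \<le> measure_pmf.expectation (cond_pmf M {\<phi>. consistent \<phi> \<psi>}) h"
      using cond_gain_ge[OF \<phi>(1) inv(3,1,2) assms(2,3)] by simp
  next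
    fix \<phi>' \<psi> assume "\<phi>' \<in> set_pmf M" "\<psi> \<in> observed i ` set_pmf M"
    then show "\<phi>' \<in> {\<phi>. consistent \<phi> \<psi>} \<longleftrightarrow> observed i \<phi>' = \<psi>"
      using consistent_observed_iff assms(1) by auto
  qed
  also have "measure_pmf.expectation M h = real k * (value_after (Suc i) - value_after i)
      - (measure_pmf.expectation M (\<lambda>\<phi>. spread (?D i \<phi> \<union> S) \<phi>) - value_after i)"
    unfolding h_def value_after_def
    by (simp add: int Bochner_Integration.integral_diff)
  finally have "measure_pmf.expectation M (\<lambda>\<phi>. spread (?D i \<phi> \<union> S) \<phi>) - value_after i
      \<le> real k * (value_after (Suc i) - value_after i)"
    by simp
  \<comment> \<open>The conditioning is gone here: both sides average over the original
    distribution, so pointwise monotonicity suffices.\<close>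
  moreover have "influence_spread E p S
      \<le> measure_pmf.expectation M (\<lambda>\<phi>. spread (?D i \<phi> \<union> S) \<phi>)"
    unfolding influence_spread_def
  proof (intro expectation_mono_finite finite_support)
    fix \<phi> assume "\<phi> \<in> set_pmf M"
    then show "spread S \<phi> \<le> spread (?D i \<phi> \<union> S) \<phi>"
      using observed_invariant[of \<phi> i] assms
      by (intro spread_mono[OF finite_nodes support_edges]) auto
  qed
  ultimately show ?thesis by simp
qed

section \<open>The approximation ratio\<close>

lemma Greedy_A_eq: "Greedy_A E p k \<pi> = value_after k"
  unfolding Greedy_A_def value_after_def
  by (intro integral_cong_AE) (auto simp: AE_measure_pmf_iff selected_seeds_eq)

text \<open>The recurrence is run with \<open>value_after\<close> as the sequence and the influence
  spread of \<open>S\<close> as its target \<open>c\<close>.\<close>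

lemma Greedy_A_ge_influence_spread:
  assumes "1 \<le> k" "S \<subseteq> V" "card S \<le> k"
  shows "(1 - 1 / exp 1) * influence_spread E p S \<le> Greedy_A E p k \<pi>"
  unfolding Greedy_A_eq
proof (rule contraction_lower_bound[OF assms(1)])
  show "0 \<le> value_after 0" "0 \<le> influence_spread E p S"
    unfolding value_after_def influence_spread_def
    by (simp_all add: spread_nonneg)
qed (rule value_after_step[OF _ assms(2,3)])

end

theorem lemma5:
  fixes V :: "'v set" and E :: "('v \<times> 'v) set" and p :: "'v \<times> 'v \<Rightarrow> real"
    and k :: nat and \<pi> :: "'v partial_realization \<Rightarrow> 'v"
  assumes "influence_graph V E p"
    and "1 \<le> k" and "k \<le> card V"
    and "greedy_rule V E p k \<pi>"
  shows "Greedy_A E p k \<pi> \<ge> (1 - 1 / exp 1) * OPT_N V E p k"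
proof -
  interpret greedy_policy V E p k \<pi>
    by unfold_locales (use assms in auto)
  let ?F = "{S. S \<subseteq> V \<and> card S \<le> k}"
  have "finite ?F"
    using finite_nodes by simp
  moreover have "{} \<in> ?F"
    by simp
  \<comment> \<open>The maximum over a finite nonempty family is attained, so the bound for a single
    seed set gives the claim.\<close>
  ultimately have "OPT_N V E p k \<in> influence_spread E p ` ?F"
    unfolding OPT_N_def by (intro Max_in) auto
  then obtain S where "S \<subseteq> V" "card S \<le> k" "OPT_N V E p k = influence_spread E p S"
    by blast
  then show ?thesis
    using Greedy_A_ge_influence_spread[OF assms(2)] by simp
qed

end
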